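(* Let $n,m\ge 1$ be integers, $\mathcal{X}$ a set of inputs, $\boldsymbol{I}:\mathcal{X}\to\mathbb{R}^n$ the (known) feature map, and let $W_S=(w_{ij})\in\mathbb{R}^{n\times m}$ and $\boldsymbol{b}_S=(b_{S,1},\dots,b_{S,m})\in\mathbb{R}^m$ be the weight matrix and bias vector of the last layer of the student network, whose output is $\mathcal{O}_\theta(\boldsymbol{x})=\tanh(\boldsymbol{I}(\boldsymbol{x})^TW_S+\boldsymbol{b}_S)$ (applied componentwise). Let $j_0\in\{1,\dots,m\}$ and let $\boldsymbol{x}\in\mathcal{X}$ be any input. Let $z_{j_0}$ be the correct value of $\mathcal{O}_{\theta,j_0}(\boldsymbol{x})$, and let $\tilde z_{j_0}$ be the value of $\mathcal{O}_{\theta,j_0}(\boldsymbol{x})$ when a SNIFF on the bias $b_{S,j_0}$ is carried out. Then \[ b_{S,j_0}=\frac14\ln\frac{(1+z_{j_0})(1-\tilde z_{j_0})}{(1-z_{j_0})(1+\tilde z_{j_0})}. \]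
   Context: All computations are in exact real arithmetic. The student network consists of a fixed known feature map $\boldsymbol{I}=(I_1,\dots,I_n):\mathcal{X}\to\mathbb{R}^n$ (the first $k-1$ layers of a public teacher network) followed by one fully connected layer with weights $W_S\in\mathbb{R}^{n\times m}$ and biases $\boldsymbol{b}_S\in\mathbb{R}^m$. For an input $\boldsymbol{x}$, put $y_j(\boldsymbol{x})=b_{S,j}+\sum_{i=1}^n I_i(\boldsymbol{x})w_{ij}$ for $j=1,\dots,m$. With tanh activation the $j$-th output is $\mathcal{O}_{\theta,j}(\boldsymbol{x})=\dfrac{\exp(y_j(\boldsymbol{x}))-\exp(-y_j(\boldsymbol{x}))}{\exp(y_j(\boldsymbol{x}))+\exp(-y_j(\boldsymbol{x}))}$. SNIFF (sign bit flip fault) on the bias $b_{S,j_0}$: during the execution on $\boldsymbol{x}$, the value $b_{S,j_0}$ is replaced by $-b_{S,j_0}$ in the computation of $y_{j_0}$; everything else is unchanged, and the activation is then applied. *)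

theory Defs
  imports "HOL-Analysis.Analysis"
begin

(* Weights W :: real^'m^'n have n rows and m columns: the paper's w_ij is W $ i $ j. *)
definition preactivation ::
    "('x \<Rightarrow> real^'n) \<Rightarrow> real^'m^'n \<Rightarrow> real^'m \<Rightarrow> 'x \<Rightarrow> real^'m" where
  "preactivation I W b x = I x v* W + b"

definition student_output ::
    "('x \<Rightarrow> real^'n) \<Rightarrow> real^'m^'n \<Rightarrow> real^'m \<Rightarrow> 'x \<Rightarrow> real^'m" where
  "student_output I W b x = (\<chi> j. tanh (preactivation I W b x $ j))"

definition flip_sign_at :: "'m \<Rightarrow> real^'m \<Rightarrow> real^'m" where
  "flip_sign_at j0 b = (\<chi> j. if j = j0 then - (b $ j) else b $ j)"

(* The fault is transient: it affects only the bias value read during this execution. *)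
definition student_output_sniff_bias ::
    "'m \<Rightarrow> ('x \<Rightarrow> real^'n) \<Rightarrow> real^'m^'n \<Rightarrow> real^'m \<Rightarrow> 'x \<Rightarrow> real^'m" where
  "student_output_sniff_bias j0 I W b x = student_output I W (flip_sign_at j0 b) x"

lemma preactivation_nth:
  "preactivation I W b x $ j = b $ j + (\<Sum>i\<in>UNIV. I x $ i * W $ i $ j)"
  by (simp add: preactivation_def vector_matrix_mult_def mult.commute)

lemma student_output_nth:
  "student_output I W b x $ j =
     (exp (preactivation I W b x $ j) - exp (- (preactivation I W b x $ j))) /
     (exp (preactivation I W b x $ j) + exp (- (preactivation I W b x $ j)))"
  by (simp add: student_output_def tanh_altdef)

(* Hence the quotients and logarithms of 1 + z and 1 - z for outputs z are genuine,
   not artefacts of division by zero or of ln outside its domain. *)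
lemma student_output_bounds:
  "- 1 < student_output I W b x $ j" "student_output I W b x $ j < 1"
  by (simp_all add: student_output_def tanh_real_gt_neg1 tanh_real_lt_1)

end

theory Submission
  imports Defs
begin

text \<open>
  The logarithm of the odds \<open>(1 + tanh y) / (1 - tanh y)\<close> is \<open>2 * y\<close>.  The fault shifts the
  preactivation at \<open>j0\<close> by \<open>- 2 * b $ j0\<close>, so the log odds of the correct and the faulty output
  differ by \<open>4 * b $ j0\<close>.
\<close>

lemma ln_tanh_odds_ratio:
  fixes u v :: real
  shows "ln (((1 + tanh u) * (1 - tanh v)) / ((1 - tanh u) * (1 + tanh v))) = 2 * (u - v)"
proof -
  have odds_pos: "(1 + tanh t) / (1 - tanh t) > 0" for t :: real
    using tanh_real_bounds[of t] by simp
  have ln_odds: "ln ((1 + tanh t) / (1 - tanh t)) = 2 * t" for t :: real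
    using artanh_tanh_real[of t] by (simp add: artanh_def)
  have "((1 + tanh u) * (1 - tanh v)) / ((1 - tanh u) * (1 + tanh v)) =
        ((1 + tanh u) / (1 - tanh u)) / ((1 + tanh v) / (1 - tanh v))"
    by simp
  then show ?thesis
    using ln_divide_pos[OF odds_pos[of u] odds_pos[of v]] by (simp only: ln_odds right_diff_distrib)
qed

lemma preactivation_flip_sign_at:
  "preactivation I W (flip_sign_at j0 b) x $ j0 = preactivation I W b x $ j0 - 2 * b $ j0"
  by (simp add: preactivation_nth flip_sign_at_def)

theorem theorem5:
  fixes X :: "'x set"
    and I :: "'x \<Rightarrow> real^'n"
    and W :: "real^'m^'n"
    and b :: "real^'m"
    and j0 :: 'm
    and x :: 'x
    and z z' :: real
  assumes "x \<in> X"
    and "z = student_output I W b x $ j0"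
    and "z' = student_output_sniff_bias j0 I W b x $ j0"
  shows "b $ j0 = 1 / 4 * ln (((1 + z) * (1 - z')) / ((1 - z) * (1 + z')))"
  unfolding assms(2,3) student_output_sniff_bias_def student_output_def vec_lambda_beta
    ln_tanh_odds_ratio preactivation_flip_sign_at
  by simp

end
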